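(* Let $n\ge 1$. If a rotation invariant monodromy factorization $(X_1,\ldots,X_n)\in(\mathrm{SL}_2\mathbb{Z})^n$ exists, then $n$ is divisible by $12$. If $n$ is divisible by $12$, there are exactly two rotation invariant monodromy factorizations $(X_1,\ldots,X_n)$ in $(\mathrm{SL}_2\mathbb{Z})^n$ up to simultaneous conjugation by $\mathrm{SL}_2\mathbb{Z}$. Explicitly, for any rotation invariant monodromy factorization $(X_1,\ldots,X_n)$ there is some matrix $D\in \mathrm{SL}_2\mathbb{Z}$ so that exactly one of the following holds: (a) $(DX_1D^{-1},\ldots,DX_nD^{-1}) = \left(\begin{pmatrix}1&-1\\0&1\end{pmatrix},\begin{pmatrix}1&0\\1&1\end{pmatrix},\begin{pmatrix}1&-1\\0&1\end{pmatrix},\ldots\right)$, the sequence continuing periodically with period $2$; or (b) $(DX_1D^{-1},\ldots,DX_nD^{-1}) = \left(\begin{pmatrix}1&-1\\0&1\end{pmatrix},\begin{pmatrix}2&-1\\1&0\end{pmatrix},\begin{pmatrix}1&0\\1&1\end{pmatrix},\begin{pmatrix}1&-1\\0&1\end{pmatrix},\ldots\right)$, the sequence continuing periodically with period $3$.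
   Context: An ordered $n$-tuple $(X_1,\ldots,X_n)\in(\mathrm{SL}_2\mathbb{Z})^n$ is called a rotation invariant monodromy factorization provided that for some $C\in \mathrm{SL}_2\mathbb{Z}$: (1) $X_1 = T_v$, where $T_v(x) = x+(x,v)v$ is the symplectic transvection in a primitive vector $v\in\mathbb{Z}^2$, with $(x,y)=x_1y_2-x_2y_1$ the standard symplectic form; equivalently, $X_1$ is conjugate in $\mathrm{SL}_2\mathbb{Z}$ to $\begin{pmatrix}1&-1\\0&1\end{pmatrix}$; (2) $X_{i+1} = CX_iC^{-1}$ for all $i\in\mathbb{Z}/n\mathbb{Z}$ (indices taken modulo $n$); (3) $\prod_{i=1}^n X_i = X_1X_2\cdots X_n = \mathrm{Id}$. Simultaneous conjugation by $D\in\mathrm{SL}_2\mathbb{Z}$ sends $(X_1,\ldots,X_n)$ to $(DX_1D^{-1},\ldots,DX_nD^{-1})$. *)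

theory Defs
  imports "HOL-Analysis.Analysis"
begin

definition SL2Z :: "(int^2^2) set" where
  "SL2Z = {A. det A = 1}"

definition symp :: "int^2 \<Rightarrow> int^2 \<Rightarrow> int" where
  "symp x y = x$1 * y$2 - x$2 * y$1"

definition primitive :: "int^2 \<Rightarrow> bool" where
  "primitive v \<longleftrightarrow> coprime (v$1) (v$2)"

definition transvection :: "int^2 \<Rightarrow> int^2^2" where
  "transvection v = matrix (\<lambda>x. x + symp x v *s v)"

definition conj_by :: "int^2^2 \<Rightarrow> int^2^2 \<Rightarrow> int^2^2" where
  "conj_by D X = D ** X ** matrix_inv D"

definition sim_conj :: "int^2^2 \<Rightarrow> (int^2^2) list \<Rightarrow> (int^2^2) list" where
  "sim_conj D Xs = map (conj_by D) Xs"

text \<open>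
  An \<open>n\<close>-tuple is a list of length \<open>n\<close>, so \<open>X\<^sub>i\<close> is \<open>Xs ! (i - 1)\<close>. The \<open>foldr\<close> below is
  the product \<open>X\<^sub>1 X\<^sub>2 \<dots> X\<^sub>n\<close> in this order.
\<close>

definition rot_inv_fact :: "nat \<Rightarrow> (int^2^2) list \<Rightarrow> bool" where
  "rot_inv_fact n Xs \<longleftrightarrow>
     length Xs = n \<and> set Xs \<subseteq> SL2Z \<and>
     (\<exists>C\<in>SL2Z.
        (\<exists>v. primitive v \<and> Xs ! 0 = transvection v) \<and>
        (\<forall>i<n. Xs ! (Suc i mod n) = conj_by C (Xs ! i)) \<and>
        foldr (**) Xs (mat 1) = mat 1)"

definition sim_conj_rel :: "nat \<Rightarrow> ((int^2^2) list \<times> (int^2^2) list) set" where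
  "sim_conj_rel n =
     {(Xs, Ys). rot_inv_fact n Xs \<and> rot_inv_fact n Ys \<and> (\<exists>D\<in>SL2Z. Ys = sim_conj D Xs)}"

definition periodic_tuple :: "nat \<Rightarrow> (int^2^2) list \<Rightarrow> (int^2^2) list" where
  "periodic_tuple n P = map (\<lambda>i. P ! (i mod length P)) [0..<n]"

definition mat2 :: "int \<Rightarrow> int \<Rightarrow> int \<Rightarrow> int \<Rightarrow> int^2^2" where
  "mat2 a b c d = vector [vector [a, b], vector [c, d]]"

definition tuple_a :: "nat \<Rightarrow> (int^2^2) list" where
  "tuple_a n = periodic_tuple n [mat2 1 (-1) 0 1, mat2 1 0 1 1]"

definition tuple_b :: "nat \<Rightarrow> (int^2^2) list" where
  "tuple_b n = periodic_tuple n [mat2 1 (-1) 0 1, mat2 2 (-1) 1 0, mat2 1 0 1 1]"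

end

(* Up to conjugation X_1 = A = (1 -1; 0 1), and X_{i+1} = C^i A C^{-i}, so the product telescopes to
   (A C)^n C^{-n}. Hence (A C)^n = C^n, and C^n commutes with A. If C has lower left entry c and
   trace t, then A C has the same lower left entry and trace t - c, and the powers are governed by
   Chebyshev polynomials in t and t - c. The lower left entry of C^n must vanish, which forces
   c to be nonzero and both C and A C to be elliptic: t and t - c lie in {-1, 0, 1}. Together with
   a parity argument excluding c = 2 and c = -2, this leaves four pairs (t, c), and comparing C^n
   with (A C)^n gives 12 | n. Replacing C by -C, which changes no X_i, one may take c = 1; then
   conjugation by a power of A makes C one of two matrices, with t = 0 or t = 1. *)

theory Submission
  imports Defs
begin

section \<open>Integral two-by-two matrices\<close>

lemma mat2_nth [simp]:
  "mat2 a b c d $ 1 $ 1 = a" "mat2 a b c d $ 1 $ 2 = b"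
  "mat2 a b c d $ 2 $ 1 = c" "mat2 a b c d $ 2 $ 2 = d"
  by (simp_all add: mat2_def)

lemma mat2_eta: "M = mat2 (M$1$1) (M$1$2) (M$2$1) (M$2$2)"
  by (simp add: vec_eq_iff forall_2)

lemma mat2_cases: obtains a b c d where "M = mat2 a b c d"
  using mat2_eta by blast

lemma mat2_eq_iff [simp]:
  "mat2 a b c d = mat2 a' b' c' d' \<longleftrightarrow> a = a' \<and> b = b' \<and> c = c' \<and> d = d'"
  by (metis mat2_nth)

lemma mat2_mult [simp]:
  "mat2 a b c d ** mat2 a' b' c' d' =
     mat2 (a * a' + b * c') (a * b' + b * d') (c * a' + d * c') (c * b' + d * d')"
  by (simp add: vec_eq_iff forall_2 matrix_matrix_mult_def sum_2)

lemma mat_1_mat2: "mat 1 = mat2 1 0 0 1"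
  by (simp add: vec_eq_iff forall_2 mat_def)

lemma det_mat2 [simp]: "det (mat2 a b c d) = a * d - b * c"
  by (simp add: det_2)

lemma mat2_in_SL2Z [simp]: "mat2 a b c d \<in> SL2Z \<longleftrightarrow> a * d - b * c = 1"
  by (simp add: SL2Z_def)

lemma SL2Z_mult: "C \<in> SL2Z \<Longrightarrow> D \<in> SL2Z \<Longrightarrow> C ** D \<in> SL2Z"
  by (simp add: SL2Z_def det_mul)

lemma SL2Z_mat_1: "mat 1 \<in> SL2Z"
  by (simp add: SL2Z_def)

text \<open>\<open>matrix_inv\<close> is a choice among two-sided inverses; these are unique, so
  exhibiting one identifies it.\<close>

lemma matrix_inv_eqI:
  fixes M :: "'a::semiring_1^'n^'n"
  assumes "M ** N = mat 1" "N ** M = mat 1"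
  shows "matrix_inv M = N"
proof -
  have "M ** matrix_inv M = mat 1 \<and> matrix_inv M ** M = mat 1"
    unfolding matrix_inv_def by (rule someI[of _ N]) (use assms in blast)
  then show ?thesis
    by (metis assms(2) matrix_mul_assoc matrix_mul_lid matrix_mul_rid)
qed

lemma matrix_inv_mat2:
  "a * d - b * c = 1 \<Longrightarrow> matrix_inv (mat2 a b c d) = mat2 d (- b) (- c) a"
  by (rule matrix_inv_eqI) (simp_all add: mat_1_mat2 algebra_simps)

lemma SL2Z_matrix_inv:
  assumes "D \<in> SL2Z"
  shows "D ** matrix_inv D = mat 1" "matrix_inv D ** D = mat 1" "matrix_inv D \<in> SL2Z"
proof -
  obtain a b c d where D: "D = mat2 a b c d"
    by (rule mat2_cases)
  with assms have "a * d - b * c = 1"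
    by simp
  then show "D ** matrix_inv D = mat 1" "matrix_inv D ** D = mat 1" "matrix_inv D \<in> SL2Z"
    by (simp_all add: D matrix_inv_mat2) (simp_all add: mat_1_mat2 algebra_simps)
qed

lemma SL2Z_cancel:
  assumes "D \<in> SL2Z"
  shows "M ** D ** matrix_inv D = M" "M ** matrix_inv D ** D = M"
  using SL2Z_matrix_inv(1,2)[OF assms] by (simp_all flip: matrix_mul_assoc)

lemma matrix_inv_mult:
  assumes "C \<in> SL2Z" "D \<in> SL2Z"
  shows "matrix_inv (C ** D) = matrix_inv D ** matrix_inv C"
proof (rule matrix_inv_eqI)
  show "C ** D ** (matrix_inv D ** matrix_inv C) = mat 1"
    using assms by (simp add: matrix_mul_assoc SL2Z_cancel SL2Z_matrix_inv)
  show "matrix_inv D ** matrix_inv C ** (C ** D) = mat 1"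
    using assms by (simp add: matrix_mul_assoc SL2Z_cancel SL2Z_matrix_inv)
qed

section \<open>Conjugation as a group action\<close>

lemma conj_by_mult:
  "C \<in> SL2Z \<Longrightarrow> D \<in> SL2Z \<Longrightarrow> conj_by (C ** D) X = conj_by C (conj_by D X)"
  by (simp add: conj_by_def matrix_inv_mult matrix_mul_assoc)

lemma conj_by_mat_1 [simp]: "conj_by (mat 1) X = X"
proof -
  have "matrix_inv (mat 1 :: int^2^2) = mat 1"
    by (rule matrix_inv_eqI) simp_all
  then show ?thesis
    by (simp add: conj_by_def)
qed

lemma conj_by_in_SL2Z: "C \<in> SL2Z \<Longrightarrow> X \<in> SL2Z \<Longrightarrow> conj_by C X \<in> SL2Z"
  by (simp add: conj_by_def SL2Z_mult SL2Z_matrix_inv)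

lemma conj_by_mat2:
  "a * d - b * c = 1 \<Longrightarrow> conj_by (mat2 a b c d) X = mat2 a b c d ** X ** mat2 d (- b) (- c) a"
  by (simp add: conj_by_def matrix_inv_mat2)

text \<open>The two signs cancel. This later allows the sign of the lower left entry of the rotating
  matrix to be chosen.\<close>

lemma conj_by_uminus:
  assumes "a * d - b * c = 1"
  shows "conj_by (mat2 (- a) (- b) (- c) (- d)) = conj_by (mat2 a b c d)"
proof
  fix X
  obtain p q r s where "X = mat2 p q r s"
    by (rule mat2_cases)
  then show "conj_by (mat2 (- a) (- b) (- c) (- d)) X = conj_by (mat2 a b c d) X"
    using assms by (simp add: conj_by_mat2 algebra_simps)
qed

lemma funpow_conj_by_conj_by:
  assumes "D \<in> SL2Z" "C \<in> SL2Z"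
  shows "conj_by D ((conj_by C ^^ i) X) = (conj_by (conj_by D C) ^^ i) (conj_by D X)"
proof (induction i)
  case (Suc i)
  have "conj_by D C ** D = D ** C"
    using assms by (simp add: conj_by_def SL2Z_cancel)
  then have "conj_by D (conj_by C Y) = conj_by (conj_by D C) (conj_by D Y)" for Y
    using assms by (simp add: conj_by_in_SL2Z flip: conj_by_mult)
  with Suc show ?case
    by simp
qed simp

section \<open>Powers and Chebyshev polynomials\<close>

primrec mpow :: "int^2^2 \<Rightarrow> nat \<Rightarrow> int^2^2" where
  "mpow C 0 = mat 1"
| "mpow C (Suc k) = mpow C k ** C"

text \<open>\<open>cheb t k\<close> is the Chebyshev value \<open>U\<^bsub>k - 1\<^esub>(t / 2)\<close>.\<close>

fun cheb :: "int \<Rightarrow> nat \<Rightarrow> int" where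
  "cheb t 0 = 0"
| "cheb t (Suc 0) = 1"
| "cheb t (Suc (Suc k)) = t * cheb t (Suc k) - cheb t k"

lemma mpow_in_SL2Z: "C \<in> SL2Z \<Longrightarrow> mpow C k \<in> SL2Z"
  by (induction k) (simp_all add: SL2Z_mat_1 SL2Z_mult)

lemma conj_by_mpow:
  assumes "C \<in> SL2Z"
  shows "conj_by (mpow C k) X = (conj_by C ^^ k) X"
proof (induction k arbitrary: X)
  case (Suc k)
  then show ?case
    using assms by (simp add: conj_by_mult mpow_in_SL2Z funpow_swap1)
qed simp

text \<open>By Cayley-Hamilton, C^k is u C minus the preceding Chebyshev value times the identity.
  That value is written as (a + d) u - w, which avoids the index k - 1 and so covers k = 0.\<close>

lemma mpow_mat2:
  assumes "a * d - b * c = 1"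
  shows "mpow (mat2 a b c d) k =
    (let u = cheb (a + d) k; w = cheb (a + d) (Suc k)
     in mat2 (w - d * u) (b * u) (c * u) (w - a * u))"
proof (induction k)
  case (Suc k)
  have "(w - d * u) * a + b * u * c = (a + d) * w - u - d * w"
    "(w - d * u) * b + b * u * d = b * w" "c * u * a + (w - a * u) * c = c * w"
    "c * u * b + (w - a * u) * d = (a + d) * w - u - a * w" for u w
    using assms by algebra+
  then show ?case
    unfolding mpow.simps Suc Let_def mat2_mult mat2_eq_iff cheb.simps by blast
qed (simp add: mat_1_mat2)

text \<open>If \<bar>y\<bar> < \<bar>x\<bar>, then \<bar>t x - y\<bar> \<ge> 2 \<bar>x\<bar> -
  \<bar>y\<bar> > \<bar>x\<bar>, so strict growth propagates along the recursion.\<close>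

lemma abs_cheb_less:
  assumes "2 \<le> \<bar>t\<bar>"
  shows "\<bar>cheb t k\<bar> < \<bar>cheb t (Suc k)\<bar>"
proof (induction k)
  case (Suc k)
  have "2 * \<bar>cheb t (Suc k)\<bar> \<le> \<bar>t * cheb t (Suc k)\<bar>"
    using assms by (simp add: abs_mult mult_right_mono)
  then show ?case
    using Suc by simp
qed simp

lemma cheb_eq_0_imp:
  assumes "cheb t k = 0" "k \<ge> 1"
  shows "t \<in> {-1, 0, 1}"
proof (rule ccontr)
  assume "t \<notin> {-1, 0, 1}"
  then have "2 \<le> \<bar>t\<bar>"
    by auto
  from abs_cheb_less[OF this, of "k - 1"] assms show False
    by simp
qed

text \<open>The sequences for t = -1, 0, 1 have periods 3, 4 and 6, whose least common multiple is
  12.\<close>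

lemma cheb_add_12:
  assumes "t \<in> {-1, 0, 1}"
  shows "cheb t (k + 12) = cheb t k"
proof -
  have "cheb t (Suc (Suc (Suc (Suc (Suc (Suc (Suc (Suc (Suc (Suc (Suc (Suc k)))))))))))) = cheb t k"
    using assms by (elim insertE emptyE) simp_all
  then show ?thesis
    by (simp add: numeral_eq_Suc del: cheb.simps)
qed

lemma cheb_mod_12:
  assumes "t \<in> {-1, 0, 1}"
  shows "cheb t (k mod 12) = cheb t k"
proof -
  have "cheb t (r + 12 * m) = cheb t r" for r m
    by (induction m) (use cheb_add_12[OF assms, of "r + 12 * _"] in \<open>simp_all add: algebra_simps\<close>)
  from this[of "k mod 12" "k div 12"] show ?thesis
    by simp
qed

lemma cheb_Suc_mod_12:
  assumes "t \<in> {-1, 0, 1}"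
  shows "cheb t (Suc (k mod 12)) = cheb t (Suc k)"
  using cheb_mod_12[OF assms, of "Suc (k mod 12)"] cheb_mod_12[OF assms, of "Suc k"]
  by (simp add: mod_Suc_eq)

text \<open>The pairs are the possible traces of C and A C. Trace 0 gives zeros at the even indices,
  trace 1 or -1 at the multiples of 3. This leaves r = 0 and r = 6, and for r = 6 the next values
  are -1 and 1.\<close>

lemma cheb_common_zero:
  assumes "r < 12" "cheb t r = 0" "cheb t' r = 0" "cheb t (Suc r) = cheb t' (Suc r)"
    and "(t, t') \<in> {(0, -1), (0, 1), (1, 0), (-1, 0)}"
  shows "r = 0"
proof -
  have "r \<in> set [0..<12]"
    using assms(1) by simp
  then have "r \<in> {0, 1, 2, 3, 4, 5, 6, 7, 8, 9, 10, 11}"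
    by (simp add: upt_rec numeral_eq_Suc)
  with assms(2-5) show ?thesis
    by (elim insertE emptyE; simp add: numeral_eq_Suc)
qed

lemma mpow_eq_mat_1:
  assumes "a * d - b * c = 1" "a + d \<in> {-1, 0, 1}" "12 dvd k"
  shows "mpow (mat2 a b c d) k = mat 1"
proof -
  have "k mod 12 = 0"
    using assms(3) by simp
  then have "cheb (a + d) k = 0" "cheb (a + d) (Suc k) = 1"
    using cheb_mod_12[OF assms(2), of k] cheb_Suc_mod_12[OF assms(2), of k] by simp_all
  then show ?thesis
    using assms(1) by (simp add: mpow_mat2 mat_1_mat2 Let_def)
qed

section \<open>Conjugation orbits\<close>

definition orbit_tuple :: "nat \<Rightarrow> int^2^2 \<Rightarrow> int^2^2 \<Rightarrow> (int^2^2) list" where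
  "orbit_tuple n C X = map (\<lambda>i. (conj_by C ^^ i) X) [0..<n]"

text \<open>The product telescopes. \<open>Y\<close> is arbitrary because the orbit grows at its
  right end, where \<open>foldr\<close> absorbs the new factor into the accumulator.\<close>

lemma foldr_orbit_tuple:
  assumes "C \<in> SL2Z"
  shows "foldr (**) (orbit_tuple n C X) Y = mpow (X ** C) n ** matrix_inv (mpow C n) ** Y"
proof (induction n arbitrary: Y)
  case 0
  have "matrix_inv (mat 1 :: int^2^2) = mat 1"
    by (rule matrix_inv_eqI) simp_all
  then show ?case
    by (simp add: orbit_tuple_def)
next
  case (Suc n)
  let ?P = "mpow C n" and ?Q = "mpow (X ** C) n"
  have P: "?P \<in> SL2Z"
    by (simp add: assms mpow_in_SL2Z)
  have "foldr (**) (orbit_tuple (Suc n) C X) Y =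
      ?Q ** matrix_inv ?P ** (conj_by ?P X ** Y)"
    using Suc[of "conj_by ?P X ** Y"] assms by (simp add: orbit_tuple_def conj_by_mpow)
  also have "\<dots> = ?Q ** (matrix_inv ?P ** ?P) ** X ** matrix_inv ?P ** Y"
    by (simp add: conj_by_def matrix_mul_assoc)
  \<comment> \<open>Inserting C C^{-1} completes one more factor X C on the left and one more C^{-1}
    on the right.\<close>
  also have "\<dots> = ?Q ** X ** (C ** matrix_inv C) ** matrix_inv ?P ** Y"
    using P assms by (simp add: SL2Z_matrix_inv)
  also have "\<dots> = mpow (X ** C) (Suc n) ** matrix_inv (mpow C (Suc n)) ** Y"
    using P assms by (simp add: matrix_inv_mult matrix_mul_assoc)
  finally show ?case .
qed

lemma eq_orbit_tupleI:
  assumes "length Xs = n" "\<And>i. i < n \<Longrightarrow> Xs ! (Suc i mod n) = conj_by C (Xs ! i)"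
  shows "Xs = orbit_tuple n C (Xs ! 0)"
proof (rule nth_equalityI)
  fix i assume "i < length Xs"
  then show "Xs ! i = orbit_tuple n C (Xs ! 0) ! i"
  proof (induction i)
    case (Suc i)
    then have "Xs ! Suc i = conj_by C (Xs ! i)"
      using assms(2)[of i] assms(1) by simp
    with Suc assms(1) show ?case
      by (simp add: orbit_tuple_def)
  qed (use assms(1) in \<open>simp add: orbit_tuple_def\<close>)
qed (simp add: assms(1) orbit_tuple_def)

lemma sim_conj_orbit_tuple:
  assumes "D \<in> SL2Z" "C \<in> SL2Z"
  shows "sim_conj D (orbit_tuple n C X) = orbit_tuple n (conj_by D C) (conj_by D X)"
  using assms by (simp add: sim_conj_def orbit_tuple_def funpow_conj_by_conj_by)

lemma sim_conj_mult:
  "C \<in> SL2Z \<Longrightarrow> D \<in> SL2Z \<Longrightarrow> sim_conj (C ** D) Xs = sim_conj C (sim_conj D Xs)"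
  by (simp add: sim_conj_def conj_by_mult)

lemma sim_conj_mat_1: "sim_conj (mat 1) Xs = Xs"
  by (simp add: sim_conj_def map_idI)

lemma sim_conj_matrix_inv:
  "D \<in> SL2Z \<Longrightarrow> sim_conj (matrix_inv D) (sim_conj D Xs) = Xs"
  by (metis SL2Z_matrix_inv(2,3) sim_conj_mat_1 sim_conj_mult)

section \<open>Normal form of the first matrix and the equations for C\<close>

lemma transvection_mat2:
  "transvection v = mat2 (1 + v$1 * v$2) (- (v$1 * v$1)) (v$2 * v$2) (1 - v$1 * v$2)"
  by (simp add: vec_eq_iff forall_2 transvection_def matrix_def symp_def axis_def algebra_simps)

lemma transvection_conj:
  assumes "primitive v"
  obtains D where "D \<in> SL2Z" "conj_by D (transvection v) = mat2 1 (-1) 0 1"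
proof -
  obtain r s where rs: "r * v$1 + s * v$2 = 1"
    using assms bezout_int[of "v$1" "v$2"] unfolding primitive_def by fastforce
  \<comment> \<open>The Bezout coefficients complete v to a matrix of determinant 1 with first
    column v. It carries the first basis vector, whose transvection is
    \<open>mat2 1 (-1) 0 1\<close>, to v.\<close>
  let ?E = "mat2 (v$1) (- s) (v$2) r"
  have E: "?E \<in> SL2Z"
    using rs by (simp add: algebra_simps)
  have "conj_by ?E (mat2 1 (-1) 0 1) = transvection v"
    using rs by (simp add: conj_by_mat2 transvection_mat2 algebra_simps)
  then have "conj_by (matrix_inv ?E) (transvection v) = mat2 1 (-1) 0 1"
    by (metis E SL2Z_matrix_inv(2,3) conj_by_mat_1 conj_by_mult)
  then show ?thesis
    using that E SL2Z_matrix_inv(3) by blast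
qed

lemma rot_inv_fact_normalize:
  assumes "n \<ge> 1" "rot_inv_fact n Xs"
  obtains D C where "D \<in> SL2Z" "C \<in> SL2Z" "sim_conj D Xs = orbit_tuple n C (mat2 1 (-1) 0 1)"
    "conj_by (mpow C n) (mat2 1 (-1) 0 1) = mat2 1 (-1) 0 1"
    "mpow (mat2 1 (-1) 0 1 ** C) n = mpow C n"
proof -
  let ?A = "mat2 1 (-1) 0 1"
  obtain C v where C: "C \<in> SL2Z" and v: "primitive v" "Xs ! 0 = transvection v"
    and step: "\<And>i. i < n \<Longrightarrow> Xs ! (Suc i mod n) = conj_by C (Xs ! i)"
    and prod: "foldr (**) Xs (mat 1) = mat 1" and len: "length Xs = n"
    using assms(2) unfolding rot_inv_fact_def by blast
  obtain D where D: "D \<in> SL2Z" "conj_by D (Xs ! 0) = ?A"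
    using v transvection_conj by metis
  let ?C = "conj_by D C"
  have C': "?C \<in> SL2Z"
    using C D by (simp add: conj_by_in_SL2Z)
  have Xs: "Xs = orbit_tuple n C (Xs ! 0)"
    using eq_orbit_tupleI len step by blast
  have orb: "sim_conj D Xs = orbit_tuple n ?C ?A"
    using sim_conj_orbit_tuple[OF D(1) C, of n "Xs ! 0"] D(2) Xs by simp
  \<comment> \<open>The wraparound condition at the last index n - 1 closes the orbit.\<close>
  have X0: "(conj_by C ^^ n) (Xs ! 0) = Xs ! 0"
  proof -
    obtain m where n: "n = Suc m"
      using assms(1) by (cases n) simp_all
    have "Xs ! m = (conj_by C ^^ m) (Xs ! 0)"
      by (subst Xs) (simp add: orbit_tuple_def n del: upt_Suc)
    then show ?thesis
      using step[of m] n by simp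
  qed
  then have fix_A: "conj_by (mpow ?C n) ?A = ?A"
    using funpow_conj_by_conj_by[OF D(1) C, of n "Xs ! 0"] D(2) C' by (simp add: conj_by_mpow)
  have foldr_conj: "foldr (**) (sim_conj D Ys) (mat 1) = conj_by D (foldr (**) Ys (mat 1))" for Ys
  proof (induction Ys)
    case Nil
    then show ?case
      using D(1) by (simp add: sim_conj_def conj_by_def SL2Z_matrix_inv)
  next
    case (Cons Y Ys)
    have "conj_by D Y ** conj_by D Z = conj_by D (Y ** Z)" for Z
      using D(1) by (simp add: conj_by_def matrix_mul_assoc SL2Z_cancel)
    with Cons show ?case
      by (simp add: sim_conj_def)
  qed
  have "mpow (?A ** ?C) n ** matrix_inv (mpow ?C n) = mat 1"
    using foldr_conj[of Xs] D(1) C' unfolding orb prod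
    by (simp add: foldr_orbit_tuple conj_by_def SL2Z_matrix_inv)
  then have "mpow (?A ** ?C) n = mpow ?C n"
    using SL2Z_cancel(2)[OF mpow_in_SL2Z[OF C', of n], of "mpow (?A ** ?C) n"] by simp
  with that D(1) C' orb fix_A show ?thesis
    by blast
qed

text \<open>Triviality of C^n closes the orbit cyclically; together with that of (A C)^n it makes
  the telescoped product the identity.\<close>

lemma rot_inv_fact_orbit_tuple:
  assumes C: "C \<in> SL2Z" and n: "n \<ge> 1"
    and "mpow C n = mat 1" "mpow (mat2 1 (-1) 0 1 ** C) n = mat 1"
  shows "rot_inv_fact n (orbit_tuple n C (mat2 1 (-1) 0 1))"
proof -
  let ?A = "mat2 1 (-1) 0 1"
  let ?Xs = "orbit_tuple n C ?A"
  have "(conj_by C ^^ i) ?A \<in> SL2Z" for i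
    by (induction i) (simp_all add: C conj_by_in_SL2Z)
  then have "set ?Xs \<subseteq> SL2Z"
    by (auto simp: orbit_tuple_def)
  moreover have "?Xs ! (Suc i mod n) = conj_by C (?Xs ! i)" if "i < n" for i
  proof (cases "Suc i = n")
    case True
    then have "conj_by C ((conj_by C ^^ i) ?A) = conj_by (mpow C n) ?A"
      using C unfolding conj_by_mpow[OF C] True[symmetric] by simp
    with True n assms(3) show ?thesis
      by (simp add: orbit_tuple_def)
  qed (use that in \<open>simp add: orbit_tuple_def\<close>)
  moreover have "foldr (**) ?Xs (mat 1) = mat 1"
    using assms by (simp add: foldr_orbit_tuple SL2Z_matrix_inv(1)[OF SL2Z_mat_1, simplified])
  moreover have "?Xs ! 0 = transvection (vector [1, 0])" "primitive (vector [1, 0])"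
    using n by (simp_all add: orbit_tuple_def transvection_mat2 primitive_def)
  moreover have "length ?Xs = n"
    by (simp add: orbit_tuple_def)
  ultimately show ?thesis
    using C unfolding rot_inv_fact_def by blast
qed

section \<open>Classification\<close>

text \<open>The square of this C is -1, so conjugation by it is an involution.\<close>

lemma orbit_tuple_eq_tuple_a:
  "orbit_tuple n (mat2 0 (-1) 1 0) (mat2 1 (-1) 0 1) = tuple_a n"
proof -
  let ?A = "mat2 1 (-1) 0 1" and ?B = "mat2 1 0 1 1" and ?f = "conj_by (mat2 0 (-1) 1 0)"
  have f: "?f ?A = ?B" "?f ?B = ?A"
    by (simp_all add: conj_by_mat2)
  have "(?f ^^ i) ?A = [?A, ?B] ! (i mod 2)" for i
  proof (induction i)
    case (Suc i)
    have "i mod 2 = 0 \<or> i mod 2 = 1"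
      by linarith
    with Suc f show ?case
      by (auto simp: mod_Suc)
  qed simp
  then show ?thesis
    by (simp add: orbit_tuple_def tuple_a_def periodic_tuple_def flip: numeral_2_eq_2)
qed

text \<open>The cube of this C is -1, so conjugation by it has period 3.\<close>

lemma orbit_tuple_eq_tuple_b:
  "orbit_tuple n (mat2 1 (-1) 1 0) (mat2 1 (-1) 0 1) = tuple_b n"
proof -
  let ?A = "mat2 1 (-1) 0 1" and ?M = "mat2 2 (-1) 1 0" and ?B = "mat2 1 0 1 1"
    and ?f = "conj_by (mat2 1 (-1) 1 0)"
  have f: "?f ?A = ?M" "?f ?M = ?B" "?f ?B = ?A"
    by (simp_all add: conj_by_mat2)
  have "(?f ^^ i) ?A = [?A, ?M, ?B] ! (i mod 3)" for i
  proof (induction i)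
    case (Suc i)
    have "i mod 3 = 0 \<or> i mod 3 = 1 \<or> i mod 3 = 2"
      by linarith
    with Suc f show ?case
      by (auto simp: mod_Suc)
  qed simp
  then show ?thesis
    by (simp add: orbit_tuple_def tuple_b_def periodic_tuple_def)
qed

text \<open>C and A C have traces 0 and -1, so their n-th powers are trivial. For
  \<open>tuple_b\<close> the traces are 1 and 0.\<close>

lemma rot_inv_fact_tuple_a: "n \<ge> 1 \<Longrightarrow> 12 dvd n \<Longrightarrow> rot_inv_fact n (tuple_a n)"
  using rot_inv_fact_orbit_tuple[of "mat2 0 (-1) 1 0" n]
  by (simp add: mpow_eq_mat_1 orbit_tuple_eq_tuple_a)

lemma rot_inv_fact_tuple_b: "n \<ge> 1 \<Longrightarrow> 12 dvd n \<Longrightarrow> rot_inv_fact n (tuple_b n)"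
  using rot_inv_fact_orbit_tuple[of "mat2 1 (-1) 1 0" n]
  by (simp add: mpow_eq_mat_1 orbit_tuple_eq_tuple_b)

text \<open>The first and third entries agree in \<open>tuple_a\<close> but not in \<open>tuple_b\<close>.\<close>

lemma not_tuple_a_and_tuple_b:
  assumes "n \<ge> 3" "D \<in> SL2Z" "sim_conj D Xs = tuple_a n"
    and "E \<in> SL2Z" "sim_conj E Xs = tuple_b n"
  shows False
proof -
  have len: "length Xs = n"
    using arg_cong[OF assms(3), of length] by (simp add: sim_conj_def tuple_a_def periodic_tuple_def)
  have D: "conj_by D (Xs ! i) = tuple_a n ! i" and E: "conj_by E (Xs ! i) = tuple_b n ! i"
    if "i < n" for i
    using that len assms(3,5) by (metis nth_map sim_conj_def)+
  have "conj_by D (Xs ! 0) = conj_by D (Xs ! 2)"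
    using D[of 0] D[of 2] assms(1) by (simp add: tuple_a_def periodic_tuple_def)
  then have "Xs ! 0 = Xs ! 2"
    by (metis SL2Z_matrix_inv(2,3) assms(2) conj_by_mat_1 conj_by_mult)
  then show False
    using E[of 0] E[of 2] assms(1) by (simp add: tuple_b_def periodic_tuple_def)
qed

lemma orbit_tuple_conj_tuple_a:
  assumes "C \<in> SL2Z" "C$2$1 = 1" "C$1$1 + C$2$2 = 0"
  shows "\<exists>D\<in>SL2Z. sim_conj D (orbit_tuple n C (mat2 1 (-1) 0 1)) = tuple_a n"
proof
  \<comment> \<open>This is a power of A, so it fixes A. As C has lower left entry 1, conjugation
    shifts its upper left entry to 0; trace and determinant then fix the rest.\<close>
  let ?D = "mat2 1 (- (C$1$1)) 0 1"
  show D: "?D \<in> SL2Z"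
    by simp
  obtain a b c d where C: "C = mat2 a b c d"
    by (rule mat2_cases)
  have c: "c = 1" and d: "d = - a"
    using assms by (simp_all add: C)
  moreover have "b = - 1 - a * a"
    using assms(1) by (simp add: C c d)
  ultimately have "conj_by ?D C = mat2 0 (-1) 1 0"
    by (simp add: C conj_by_mat2)
  moreover have "conj_by ?D (mat2 1 (-1) 0 1) = mat2 1 (-1) 0 1"
    by (simp add: conj_by_mat2)
  ultimately show "sim_conj ?D (orbit_tuple n C (mat2 1 (-1) 0 1)) = tuple_a n"
    using D assms(1) by (simp add: sim_conj_orbit_tuple orbit_tuple_eq_tuple_a)
qed

lemma orbit_tuple_conj_tuple_b:
  assumes "C \<in> SL2Z" "C$2$1 = 1" "C$1$1 + C$2$2 = 1"
  shows "\<exists>D\<in>SL2Z. sim_conj D (orbit_tuple n C (mat2 1 (-1) 0 1)) = tuple_b n"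
proof
  \<comment> \<open>Here the shift brings the upper left entry to 1.\<close>
  let ?D = "mat2 1 (1 - C$1$1) 0 1"
  show D: "?D \<in> SL2Z"
    by simp
  obtain a b c d where C: "C = mat2 a b c d"
    by (rule mat2_cases)
  have c: "c = 1" and d: "d = 1 - a"
    using assms by (simp_all add: C)
  have b: "b = a * (1 - a) - 1"
    using assms(1) by (simp add: C c d)
  have "conj_by ?D C = mat2 1 (-1) 1 0"
    by (simp add: C b c d conj_by_mat2 algebra_simps)
  moreover have "conj_by ?D (mat2 1 (-1) 0 1) = mat2 1 (-1) 0 1"
    by (simp add: conj_by_mat2)
  ultimately show "sim_conj ?D (orbit_tuple n C (mat2 1 (-1) 0 1)) = tuple_b n"
    using D assms(1) by (simp add: sim_conj_orbit_tuple orbit_tuple_eq_tuple_b)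
qed

lemma rot_inv_fact_classification:
  assumes n: "n \<ge> 1" and "rot_inv_fact n Xs"
  shows "12 dvd n"
    and "(\<exists>D\<in>SL2Z. sim_conj D Xs = tuple_a n) \<or> (\<exists>D\<in>SL2Z. sim_conj D Xs = tuple_b n)"
proof -
  let ?A = "mat2 1 (-1) 0 1"
  obtain D C where D: "D \<in> SL2Z" and C: "C \<in> SL2Z"
    and Xs: "sim_conj D Xs = orbit_tuple n C ?A"
    and comm: "conj_by (mpow C n) ?A = ?A"
    and pow: "mpow (?A ** C) n = mpow C n"
    using rot_inv_fact_normalize[OF assms] .
  obtain a b c d where C_eq: "C = mat2 a b c d"
    by (rule mat2_cases)
  have det: "a * d - b * c = 1"
    using C by (simp add: C_eq)
  define t where "t = a + d"
  define u where "u = cheb t n"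
  define u' where "u' = cheb (t - c) n"
  have Cn: "mpow C n = mat2 (cheb t (Suc n) - d * u) (b * u) (c * u) (cheb t (Suc n) - a * u)"
    using det by (simp add: C_eq mpow_mat2 Let_def u_def t_def)
  have AC: "?A ** C = mat2 (a - c) (b - d) c d"
    by (simp add: C_eq)
  have tr: "a - c + d = t - c"
    by (simp add: t_def)
  have det': "(a - c) * d - (b - d) * c = 1"
    using det by (simp add: algebra_simps)
  have ACn: "mpow (?A ** C) n = mat2 (cheb (t - c) (Suc n) - d * u') ((b - d) * u') (c * u')
      (cheb (t - c) (Suc n) - (a - c) * u')"
    unfolding AC mpow_mat2[OF det'] tr Let_def u'_def ..
  \<comment> \<open>Comparing upper left entries of the two products shows that the lower left entry
    of C^n vanishes.\<close>
  have "mpow C n ** ?A = ?A ** mpow C n"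
    using SL2Z_cancel(2)[OF mpow_in_SL2Z[OF C, of n], of "mpow C n ** ?A"] comm
    by (simp add: conj_by_def)
  then have cu: "c * u = 0"
    by (simp add: Cn)
  have cu': "c * u' = c * u" and bu': "(b - d) * u' = b * u"
    and diag: "cheb (t - c) (Suc n) - d * u' = cheb t (Suc n) - d * u"
    using pow unfolding ACn Cn by simp_all
  \<comment> \<open>If c = 0, then a = d = 1 or a = d = -1, so the trace is 2 or -2. Both traces
    agree, hence u' = u, and the upper right entries give d u = 0, against the growth of the
    Chebyshev values.\<close>
  have c: "c \<noteq> 0"
  proof
    assume c: "c = 0"
    then have "u' = u" "a * d = 1"
      using det by (simp_all add: u_def u'_def)
    moreover from \<open>a * d = 1\<close> have d: "d \<noteq> 0" and t: "t \<notin> {-1, 0, 1}"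
      by (auto simp: zmult_eq_1_iff t_def)
    ultimately have "u = 0"
      using bu' by (simp add: algebra_simps)
    with t show False
      using cheb_eq_0_imp[of t n] n by (simp add: u_def)
  qed
  then have u: "u = 0" "u' = 0"
    using cu cu' by simp_all
  then have t: "t \<in> {-1, 0, 1}" and t': "t - c \<in> {-1, 0, 1}"
    using cheb_eq_0_imp[OF _ n] by (simp_all only: u_def u'_def)
  have det_t: "a * (t - a) - b * c = 1"
    using det by (simp add: t_def)
  \<comment> \<open>One of a and t - a is even when t is odd, so the determinant would be
    even.\<close>
  have odd_c: False if "even c" "odd t"
  proof -
    have "even (a * (t - a))" "even (b * c)"
      using that by auto
    moreover have "a * (t - a) = 1 + b * c"
      using det_t by simp
    ultimately show False
      by (metis even_add odd_one)
  qed
  \<comment> \<open>The bounds on t and t - c give \<bar>c\<bar> \<le> 2, and \<bar>c\<bar> = 2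
    would force t to be 1 or -1, which parity excludes.\<close>
  have cases: "(c = 1 \<and> (t = 0 \<or> t = 1)) \<or> (c = - 1 \<and> (t = 0 \<or> t = - 1))"
  proof -
    have "c \<noteq> 2 \<or> even t" "c \<noteq> - 2 \<or> even t"
      using odd_c by fastforce+
    then show ?thesis
      using t t' c by auto
  qed
  \<comment> \<open>As u and u' vanish, equality of the upper left entries becomes equality of the
    Chebyshev values at n + 1.\<close>
  have U: "cheb t (n mod 12) = 0" "cheb (t - c) (n mod 12) = 0"
    "cheb t (Suc (n mod 12)) = cheb (t - c) (Suc (n mod 12))"
    using u diag t t' unfolding u_def u'_def
    by (simp_all only: cheb_mod_12 cheb_Suc_mod_12)
  have "n mod 12 = 0"
    using cheb_common_zero[OF _ U] cases by force
  then show "12 dvd n"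
    by auto
  \<comment> \<open>Passing to -C negates both c and t, which reduces c = -1 to c = 1.\<close>
  have neg: "orbit_tuple n C ?A = orbit_tuple n (mat2 (- a) (- b) (- c) (- d)) ?A"
    using det by (simp add: orbit_tuple_def C_eq conj_by_uminus)
  have "(\<exists>E\<in>SL2Z. sim_conj E (orbit_tuple n C ?A) = tuple_a n)
      \<or> (\<exists>E\<in>SL2Z. sim_conj E (orbit_tuple n C ?A) = tuple_b n)"
    using cases
  proof (elim disjE conjE)
    assume "c = 1" "t = 0"
    then show ?thesis
      using orbit_tuple_conj_tuple_a[OF C] by (simp add: C_eq t_def)
  next
    assume "c = 1" "t = 1"
    then show ?thesis
      using orbit_tuple_conj_tuple_b[OF C] by (simp add: C_eq t_def)
  next
    assume "c = - 1" "t = 0"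
    then show ?thesis
      using orbit_tuple_conj_tuple_a[of "mat2 (- a) (- b) (- c) (- d)"] det
      unfolding neg by (simp add: t_def)
  next
    assume "c = - 1" "t = - 1"
    then show ?thesis
      using orbit_tuple_conj_tuple_b[of "mat2 (- a) (- b) (- c) (- d)"] det
      unfolding neg by (simp add: t_def)
  qed
  then show "(\<exists>D\<in>SL2Z. sim_conj D Xs = tuple_a n) \<or> (\<exists>D\<in>SL2Z. sim_conj D Xs = tuple_b n)"
    unfolding Xs[symmetric] by (metis D SL2Z_mult sim_conj_mult)
qed

section \<open>Counting the conjugacy classes\<close>

lemma equiv_sim_conj_rel: "equiv {Xs. rot_inv_fact n Xs} (sim_conj_rel n)"
proof (rule equivI)
  show "sim_conj_rel n \<subseteq> {Xs. rot_inv_fact n Xs} \<times> {Xs. rot_inv_fact n Xs}"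
    by (auto simp: sim_conj_rel_def)
  show "refl_on {Xs. rot_inv_fact n Xs} (sim_conj_rel n)"
    by (auto simp: refl_on_def sim_conj_rel_def sim_conj_mat_1 intro!: bexI[OF _ SL2Z_mat_1])
  show "sym (sim_conj_rel n)"
    by (auto simp: sym_def sim_conj_rel_def sim_conj_matrix_inv
        intro!: bexI[OF _ SL2Z_matrix_inv(3)])
  show "trans (sim_conj_rel n)"
    by (auto simp: trans_def sim_conj_rel_def simp flip: sim_conj_mult intro: SL2Z_mult)
qed

theorem theorem1p2:
  fixes n :: nat
  assumes "n \<ge> 1"
  shows "((\<exists>Xs. rot_inv_fact n Xs) \<longrightarrow> 12 dvd n) \<and>
    (12 dvd n \<longrightarrow> card ({Xs. rot_inv_fact n Xs} // sim_conj_rel n) = 2) \<and>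
    (\<forall>Xs. rot_inv_fact n Xs \<longrightarrow>
       ((\<exists>D\<in>SL2Z. sim_conj D Xs = tuple_a n) \<and> \<not> (\<exists>D\<in>SL2Z. sim_conj D Xs = tuple_b n)) \<or>
       (\<not> (\<exists>D\<in>SL2Z. sim_conj D Xs = tuple_a n) \<and> (\<exists>D\<in>SL2Z. sim_conj D Xs = tuple_b n)))"
proof (intro conjI impI allI)
  show "12 dvd n" if "\<exists>Xs. rot_inv_fact n Xs"
    using that rot_inv_fact_classification(1) assms by blast
next
  assume "12 dvd n"
  \<comment> \<open>The two normal forms are told apart at index 2, which must exist.\<close>
  then have n: "n \<ge> 3"
    using assms by (auto dest: dvd_imp_le)
  let ?S = "{Xs. rot_inv_fact n Xs}" and ?r = "sim_conj_rel n"
  let ?a = "tuple_a n" and ?b = "tuple_b n"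
  have ab: "?a \<in> ?S" "?b \<in> ?S"
    using assms \<open>12 dvd n\<close> by (simp_all add: rot_inv_fact_tuple_a rot_inv_fact_tuple_b)
  \<comment> \<open>Apply the exclusion lemma to \<open>tuple_a n\<close> itself, with the identity
    as first conjugator.\<close>
  have "(?a, ?b) \<notin> ?r"
    using not_tuple_a_and_tuple_b[OF n SL2Z_mat_1 sim_conj_mat_1] by (auto simp: sim_conj_rel_def dest: sym)
  then have neq: "?r `` {?a} \<noteq> ?r `` {?b}"
    using eq_equiv_class_iff[OF equiv_sim_conj_rel ab] by simp
  have "?r `` {Xs} \<in> {?r `` {?a}, ?r `` {?b}}" if "Xs \<in> ?S" for Xs
  proof -
    have "(Xs, ?a) \<in> ?r \<or> (Xs, ?b) \<in> ?r"
      using rot_inv_fact_classification(2)[OF assms] that ab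
      unfolding sim_conj_rel_def by fastforce
    then show ?thesis
      using equiv_class_eq[OF equiv_sim_conj_rel] by blast
  qed
  then have "?S // ?r = {?r `` {?a}, ?r `` {?b}}"
    using ab by (auto simp: quotient_def)
  with neq show "card (?S // ?r) = 2"
    by simp
next
  fix Xs
  assume Xs: "rot_inv_fact n Xs"
  then have "n \<ge> 3"
    using rot_inv_fact_classification(1)[OF assms Xs] assms by (auto dest: dvd_imp_le)
  then show "((\<exists>D\<in>SL2Z. sim_conj D Xs = tuple_a n) \<and> \<not> (\<exists>D\<in>SL2Z. sim_conj D Xs = tuple_b n)) \<or>
       (\<not> (\<exists>D\<in>SL2Z. sim_conj D Xs = tuple_a n) \<and> (\<exists>D\<in>SL2Z. sim_conj D Xs = tuple_b n))"
    using rot_inv_fact_classification(2)[OF assms Xs] not_tuple_a_and_tuple_b by blast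
qed

end
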